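(* Let $m,n\in\mathbb{N}$. Let $$J_{m,n}:=\left\{(a,b,c,d,\ell)\in \mathbb{N}^5:\ a\mid m,\ b\mid a,\ c\mid n,\ d\mid c,\ \frac{a}{b}=\frac{c}{d},\ \ell\le \frac{a}{b},\ \gcd\left(\ell,\frac{a}{b}\right)=1\right\},$$ and for $(a,b,c,d,\ell)\in J_{m,n}$ define the subset of $\mathbb{Z}_m\times\mathbb{Z}_n$ $$K_{a,b,c,d,\ell}:=\left\{\left(i\frac{m}{a},\ i\ell\frac{n}{c}+j\frac{n}{d}\right): 0\le i\le a-1,\ 0\le j\le d-1\right\}.$$ Then: (i) The map $(a,b,c,d,\ell)\mapsto K_{a,b,c,d,\ell}$ is a bijection between the set $J_{m,n}$ and the set of subgroups of $(\mathbb{Z}_m\times\mathbb{Z}_n,+)$. (ii) For every $(a,b,c,d,\ell)\in J_{m,n}$, the invariant factor decomposition of the subgroup $K_{a,b,c,d,\ell}$ is $$K_{a,b,c,d,\ell}\simeq \mathbb{Z}_{\gcd(b,d)}\times\mathbb{Z}_{\operatorname{lcm}(a,c)}.$$ (iii) For every $(a,b,c,d,\ell)\in J_{m,n}$, the order of the subgroup $K_{a,b,c,d,\ell}$ is $ad$ and its exponent is $\operatorname{lcm}(a,c)$. (iv) For every $(a,b,c,d,\ell)\in J_{m,n}$, the subgroup $K_{a,b,c,d,\ell}$ is cyclic if and only if $\gcd(b,d)=1$.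
   Context: $\mathbb{N}=\{1,2,\ldots\}$. $\mathbb{Z}_m$ denotes the additive group of residue classes modulo $m$; an integer in the first (second) coordinate of a pair stands for its residue class modulo $m$ (modulo $n$). For a finite abelian group of rank at most two, the invariant factor decomposition is the isomorphism with $\mathbb{Z}_u\times\mathbb{Z}_v$ where $u,v\in\mathbb{N}$ and $u\mid v$ (factors $\mathbb{Z}_1$ being trivial); in (ii) the divisibility $\gcd(b,d)\mid\operatorname{lcm}(a,c)$ is part of the meaning. *)

theory Defs
  imports "HOL-Algebra.Elementary_Groups"
begin

text \<open>
  \<^const>\<open>integer_mod_group\<close> models residue classes by their representatives
  in \<open>{0..<m}\<close>, so an integer standing for its class becomes that integer modulo \<open>m\<close>.
\<close>

abbreviation Z_prod :: "nat \<Rightarrow> nat \<Rightarrow> (int \<times> int) monoid" where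
  "Z_prod m n \<equiv> integer_mod_group m \<times>\<times> integer_mod_group n"

text \<open>All divisions \<open>div\<close> below are exact for parameters in \<open>J m n\<close>.\<close>

definition J :: "nat \<Rightarrow> nat \<Rightarrow> (nat \<times> nat \<times> nat \<times> nat \<times> nat) set" where
  "J m n = {(a, b, c, d, l).
     0 < a \<and> 0 < b \<and> 0 < c \<and> 0 < d \<and> 0 < l \<and>
     a dvd m \<and> b dvd a \<and> c dvd n \<and> d dvd c \<and>
     a div b = c div d \<and> l \<le> a div b \<and> gcd l (a div b) = 1}"

definition K :: "nat \<Rightarrow> nat \<Rightarrow> nat \<Rightarrow> nat \<Rightarrow> nat \<Rightarrow> nat \<Rightarrow> nat \<Rightarrow> (int \<times> int) set" where
  "K m n a b c d l =
     {(int (i * (m div a)) mod int m,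
       int (i * l * (n div c) + j * (n div d)) mod int n) | i j. i < a \<and> j < d}"

text \<open>
  The exponent of a group; the value is unspecified if the group has no finite exponent
  (which cannot happen for finite groups).
\<close>

definition group_exponent :: "('a, 'b) monoid_scheme \<Rightarrow> nat" where
  "group_exponent G = (LEAST e::nat. 0 < e \<and> (\<forall>x\<in>carrier G. x [^]\<^bsub>G\<^esub> e = \<one>\<^bsub>G\<^esub>))"

text \<open>
  \<open>\<int>\<^sub>u \<times> \<int>\<^sub>v\<close> is the invariant factor decomposition of \<open>G\<close>, a finite
  abelian group of rank at most two. Positivity matters because
  \<open>integer_mod_group 0\<close> is the infinite cyclic group.
\<close>

definition invariant_factor_decomp :: "('a, 'b) monoid_scheme \<Rightarrow> nat \<Rightarrow> nat \<Rightarrow> bool" where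
  "invariant_factor_decomp G u v \<longleftrightarrow> 0 < u \<and> 0 < v \<and> u dvd v \<and> G \<cong> Z_prod u v"

end

theory Submission
  imports Defs "HOL-Computational_Algebra.Primes"
begin

text \<open>
  Write \<open>s = a/b = c/d\<close>, \<open>m' = m/a\<close>, \<open>n' = n/c\<close>. The preimage of \<open>K\<close> in \<open>\<int>\<^sup>2\<close> is the lattice of
  all \<open>(m' p, n' (l p + s t))\<close> with integers \<open>p\<close>, \<open>t\<close>. Subgroups of \<open>\<int>\<^sub>m \<times> \<int>\<^sub>n\<close> correspond to
  lattices containing \<open>m\<int> \<times> n\<int>\<close>, and such a lattice determines \<open>m'\<close> and \<open>n'\<close> through its
  projections, \<open>s\<close> through its intersection with the second axis, and \<open>l\<close> modulo \<open>s\<close> through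
  the point \<open>(m', n' l)\<close>.

  In the coordinates \<open>(p, t)\<close>, the lattice \<open>m\<int> \<times> n\<int>\<close> is spanned by \<open>(a, -l b)\<close> and \<open>(0, d)\<close>.
  With \<open>g = gcd b d\<close>, the Smith normal form of this relation matrix is
  \<open>diag(g, a d / g) = diag(g, lcm a c)\<close>, which yields the invariant factors; order, exponent and
  cyclicity are read off from them.
\<close>

section \<open>Images of linear maps from the integer plane to \<open>Z_prod m n\<close>\<close>

lemma group_Z_prod: "group (Z_prod m n)"
  by (simp add: DirProd_group)

lemma pow_Z_prod:
  "x [^]\<^bsub>Z_prod m n\<^esub> (k::nat) = (int k * fst x mod int m, int k * snd x mod int n)"
  by (induction k) (simp_all add: mult_DirProd' mod_add_right_eq mod_add_left_eq algebra_simps)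

text \<open>First isomorphism theorem on representatives: by \<open>ker\<close>, the fibres of the
  map \<open>h\<close> are exactly the residue classes modulo \<open>u\<close> and \<open>v\<close>.
  So \<open>h\<close> restricted to the representatives that form \<open>Z_prod u v\<close> is
  injective, additive, and still reaches all of \<open>S\<close>.\<close>

lemma linear_range_Z_prod:
  fixes f g :: "int \<Rightarrow> int \<Rightarrow> int"
  assumes f: "\<And>x y. f x y = f1 * x + f2 * y" and g: "\<And>x y. g x y = g1 * x + g2 * y"
    and pos: "0 < m" "0 < n" "0 < u" "0 < v"
    and ker: "\<And>x y. int m dvd f x y \<and> int n dvd g x y \<longleftrightarrow> int u dvd x \<and> int v dvd y"
    and S: "S = range (\<lambda>(x, y). (f x y mod int m, g x y mod int n))"
  shows "subgroup S (Z_prod m n)" and "Z_prod m n\<lparr>carrier := S\<rparr> \<cong> Z_prod u v"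
proof -
  define h where "h = (\<lambda>(x, y). (f x y mod int m, g x y mod int n))"
  have diff: "f (x - x') (y - y') = f x y - f x' y'" "g (x - x') (y - y') = g x y - g x' y'"
    for x y x' y' by (simp_all add: f g algebra_simps)
  have sum: "f (x + x') (y + y') = f x y + f x' y'" "g (x + x') (y + y') = g x y + g x' y'"
    for x y x' y' by (simp_all add: f g algebra_simps)
  have eq: "h (x, y) = h (x', y') \<longleftrightarrow> x mod int u = x' mod int u \<and> y mod int v = y' mod int v"
    for x y x' y'
    using ker[of "x - x'" "y - y'"] by (simp add: h_def diff mod_eq_dvd_iff)
  have h_mod: "h (x mod int u, y mod int v) = h (x, y)" for x y
    by (simp add: eq)
  have mult: "h (x + x', y + y') = h (x, y) \<otimes>\<^bsub>Z_prod m n\<^esub> h (x', y')" for x y x' y'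
    by (simp add: h_def sum mod_add_eq)
  have img: "S = h ` carrier (Z_prod u v)"
  proof -
    have "h (x, y) \<in> h ` carrier (Z_prod u v)" for x y
      using pos by (subst h_mod[symmetric]) (auto simp: carrier_integer_mod_group)
    then show ?thesis unfolding S h_def[symmetric] by auto
  qed
  have hom: "h \<in> hom (Z_prod u v) (Z_prod m n)"
  proof (rule homI)
    show "h x \<in> carrier (Z_prod m n)" for x
      using pos by (cases x) (simp add: h_def carrier_integer_mod_group)
    show "h (x \<otimes>\<^bsub>Z_prod u v\<^esub> y) = h x \<otimes>\<^bsub>Z_prod m n\<^esub> h y" for x y
      by (cases x; cases y) (simp only: mult_DirProd mult_integer_mod_group h_mod mult)
  qed
  interpret group_hom "Z_prod u v" "Z_prod m n" h
    using hom by (simp add: group_hom_def group_hom_axioms_def group_Z_prod)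
  show "subgroup S (Z_prod m n)"
    unfolding img by (rule img_is_subgroup)
  have "inj_on h (carrier (Z_prod u v))"
  proof (rule inj_onI)
    fix x y assume "x \<in> carrier (Z_prod u v)" "y \<in> carrier (Z_prod u v)" "h x = h y"
    then show "x = y"
      using pos by (cases x; cases y) (auto simp: carrier_integer_mod_group eq)
  qed
  then have "h \<in> iso (Z_prod u v) (Z_prod m n\<lparr>carrier := S\<rparr>)"
    using hom by (auto simp: iso_def hom_def img bij_betw_def)
  then show "Z_prod m n\<lparr>carrier := S\<rparr> \<cong> Z_prod u v"
    using group.iso_sym[OF group_Z_prod] is_isoI by blast
qed

section \<open>Order, exponent and cyclicity from the invariant factors\<close>

lemma group_exponent_iso:
  assumes "G \<cong> H" "group G" "group H"
  shows "group_exponent G = group_exponent H"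
proof -
  obtain h where h: "h \<in> iso G H"
    using assms(1) by (auto simp: is_iso_def)
  interpret group_hom G H h
    using h assms by (simp add: group_hom_def group_hom_axioms_def iso_def)
  have inj: "inj_on h (carrier G)" and surj: "carrier H = h ` carrier G"
    using h by (auto simp: iso_def bij_betw_def)
  have "h x [^]\<^bsub>H\<^esub> e = \<one>\<^bsub>H\<^esub> \<longleftrightarrow> x [^]\<^bsub>G\<^esub> e = \<one>\<^bsub>G\<^esub>" if "x \<in> carrier G" for x and e :: nat
    using that inj hom_nat_pow[of x e]
    by (metis G.nat_pow_closed G.one_closed hom_one inj_onD)
  then show ?thesis
    by (simp add: group_exponent_def surj)
qed

lemma group_exponent_Z_prod:
  assumes "0 < u" "0 < v" "u dvd v"
  shows "group_exponent (Z_prod u v) = v"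
  unfolding group_exponent_def
proof (rule Least_equality)
  show "0 < v \<and> (\<forall>x\<in>carrier (Z_prod u v). x [^]\<^bsub>Z_prod u v\<^esub> v = \<one>\<^bsub>Z_prod u v\<^esub>)"
    using assms by (auto simp: pow_Z_prod)
next
  fix e :: nat assume e: "0 < e \<and> (\<forall>x\<in>carrier (Z_prod u v). x [^]\<^bsub>Z_prod u v\<^esub> e = \<one>\<^bsub>Z_prod u v\<^esub>)"
  show "v \<le> e"
  \<comment> \<open>The witness \<open>(0, 1)\<close> has order \<open>v\<close>; for
    \<open>v = 1\<close> it is not a reduced representative, whence the split.\<close>
  proof (cases "v = 1")
    case False
    then have "(0, 1) \<in> carrier (Z_prod u v)"
      using assms by (simp add: carrier_integer_mod_group)
    with e have "(0, 1) [^]\<^bsub>Z_prod u v\<^esub> e = \<one>\<^bsub>Z_prod u v\<^esub>"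
      by blast
    then have "int e mod int v = 0"
      by (simp add: pow_Z_prod)
    then have "v dvd e"
      by (metis dvd_eq_mod_eq_0 int_dvd_int_iff)
    then show ?thesis
      using e by (simp add: dvd_imp_le)
  qed (use e in simp)
qed

text \<open>Since \<open>u\<close> divides \<open>v\<close>, every element is killed by
  \<open>v\<close>, so a generator has at most \<open>v\<close> distinct powers, while the group has
  \<open>u * v\<close> elements. Conversely, for \<open>u = 1\<close> the second factor is the whole
  group.\<close>

lemma cyclic_Z_prod_iff:
  assumes "0 < u" "0 < v" "u dvd v"
  shows "cyclic_group (Z_prod u v) \<longleftrightarrow> u = 1"
proof -
  interpret group "Z_prod u v" by (rule group_Z_prod)
  show ?thesis
  proof
    assume "cyclic_group (Z_prod u v)"
    then obtain x where x: "x \<in> carrier (Z_prod u v)"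
      and range: "carrier (Z_prod u v) = range (\<lambda>k::int. x [^]\<^bsub>Z_prod u v\<^esub> k)"
      unfolding cyclic_group by blast
    have "x [^]\<^bsub>Z_prod u v\<^esub> v = \<one>\<^bsub>Z_prod u v\<^esub>"
      using assms by (auto simp: pow_Z_prod)
    then have v: "x [^]\<^bsub>Z_prod u v\<^esub> int v = \<one>\<^bsub>Z_prod u v\<^esub>"
      by (simp add: int_pow_int)
    have "x [^]\<^bsub>Z_prod u v\<^esub> k = x [^]\<^bsub>Z_prod u v\<^esub> (k mod int v)" for k
    proof -
      have "x [^]\<^bsub>Z_prod u v\<^esub> (int v * (k div int v) + k mod int v)
          = (x [^]\<^bsub>Z_prod u v\<^esub> int v) [^]\<^bsub>Z_prod u v\<^esub> (k div int v) \<otimes>\<^bsub>Z_prod u v\<^esub>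
            x [^]\<^bsub>Z_prod u v\<^esub> (k mod int v)"
        by (simp only: int_pow_mult[OF x] int_pow_pow[OF x])
      also have "\<dots> = x [^]\<^bsub>Z_prod u v\<^esub> (k mod int v)"
        unfolding v int_pow_one by (rule l_one[OF int_pow_closed[OF x]])
      finally have "x [^]\<^bsub>Z_prod u v\<^esub> (int v * (k div int v) + k mod int v)
          = x [^]\<^bsub>Z_prod u v\<^esub> (k mod int v)" .
      then show ?thesis by simp
    qed
    then have "carrier (Z_prod u v) \<subseteq> (\<lambda>k. x [^]\<^bsub>Z_prod u v\<^esub> k) ` {0..<int v}"
      unfolding range using assms(2) by (auto simp del: carrier_DirProd intro!: image_eqI[of _ _ "k mod int v" for k])
    then have "card (carrier (Z_prod u v)) \<le> v"
      using surj_card_le[of "{0..<int v}"] by simp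
    then show "u = 1"
      using assms by (simp add: carrier_integer_mod_group card_cartesian_product)
  next
    assume u: "u = 1"
    \<comment> \<open>The reduction \<open>1 mod int v\<close> keeps the generator inside the
      carrier when \<open>v = 1\<close>.\<close>
    let ?x = "(0, 1 mod int v) :: int \<times> int"
    have x: "?x \<in> carrier (Z_prod u v)"
      using assms by (simp add: carrier_integer_mod_group)
    have "y \<in> range (\<lambda>k::int. ?x [^]\<^bsub>Z_prod u v\<^esub> k)" if "y \<in> carrier (Z_prod u v)" for y
    proof -
      have "y = ?x [^]\<^bsub>Z_prod u v\<^esub> (nat (snd y))"
        using that assms u by (auto simp: carrier_integer_mod_group pow_Z_prod mod_mult_right_eq)
      then show ?thesis
        by (metis int_pow_int rangeI)
    qed
    then show "cyclic_group (Z_prod u v)"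
      using x unfolding cyclic_group by blast
  qed
qed

lemma invariant_factor_decomp_consequences:
  assumes "invariant_factor_decomp G u v" "group G"
  shows "order G = u * v" "group_exponent G = v" "cyclic_group G \<longleftrightarrow> u = 1"
proof -
  have uv: "0 < u" "0 < v" "u dvd v" and iso: "G \<cong> Z_prod u v"
    using assms(1) by (auto simp: invariant_factor_decomp_def)
  show "order G = u * v"
    using iso_same_card[OF iso] uv by (simp add: order_def carrier_integer_mod_group card_cartesian_product)
  show "group_exponent G = v"
    using group_exponent_iso[OF iso assms(2) group_Z_prod] group_exponent_Z_prod[OF uv] by simp
  show "cyclic_group G \<longleftrightarrow> u = 1"
    using isomorphic_group_cyclicity[OF iso assms(2) group_Z_prod] cyclic_Z_prod_iff[OF uv] by simp
qed

section \<open>Coprime terms of arithmetic progressions\<close>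

lemma coprime_arithmetic_progression:
  fixes a b d :: int
  assumes "a \<noteq> 0" "gcd (gcd a b) d = 1"
  shows "\<exists>k. coprime a (b + k * d)"
proof -
  \<comment> \<open>With this \<open>k\<close>, each prime factor of \<open>a\<close> divides
    exactly one of \<open>b\<close> and \<open>k * d\<close>, hence not their sum: if it divides
    \<open>b\<close>, it divides neither \<open>d\<close> nor \<open>k\<close>; otherwise it divides
    \<open>k\<close>.\<close>
  define k where "k = \<Prod>{p. p \<in> prime_factors a \<and> \<not> p dvd b}"
  have fin: "finite {p. p \<in> prime_factors a \<and> \<not> p dvd b}" by simp
  have "\<not> p dvd b + k * d" if p: "prime p" "p dvd a" for p
  proof (cases "p dvd b")
    case True
    have "\<not> p dvd d"
      using assms(2) True p by (metis dvd_def gcd_greatest not_prime_unit)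
    moreover have "\<not> p dvd k"
    proof
      assume "p dvd k"
      then obtain q where "q \<in> prime_factors a" "\<not> q dvd b" "p dvd q"
        using fin p(1) by (auto simp: k_def prime_dvd_prod_iff)
      then show False
        using p(1) True by (metis in_prime_factors_imp_prime primes_dvd_imp_eq)
    qed
    ultimately show ?thesis
      using True p(1) by (simp add: dvd_add_right_iff prime_dvd_mult_iff)
  next
    case False
    then have "p dvd k"
      unfolding k_def using p assms(1) fin
      by (intro dvd_prodI[of _ _ "\<lambda>x. x", simplified]) (auto simp: prime_factors_dvd)
    then show ?thesis
      using False by (simp add: dvd_add_left_iff)
  qed
  then have "is_unit (gcd a (b + k * d))"
    using assms(1) prime_divisor_exists[of "gcd a (b + k * d)"] by auto
  then show ?thesis
    unfolding is_unit_gcd by (rule exI)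
qed

section \<open>The parameters and the lattice over \<open>K\<close>\<close>

text \<open>Trades the exact divisions in \<open>J\<close> and \<open>K\<close> for products, so
  that later steps are polynomial arithmetic in \<open>b\<close>, \<open>d\<close>,
  \<open>s\<close>, \<open>m'\<close>, \<open>n'\<close>.\<close>

lemma J_cases:
  assumes "(a, b, c, d, l) \<in> J m n" "0 < m" "0 < n"
  obtains s m' n' where "a = b * s" "c = d * s" "m = m' * a" "n = n' * c"
    "m div a = m'" "n div c = n'" "n div d = n' * s" "a div b = s"
    "0 < b" "0 < d" "0 < s" "0 < m'" "0 < n'" "0 < l" "l \<le> s" "coprime l s"
proof -
  define s where "s = a div b"
  have J: "0 < a" "0 < b" "0 < c" "0 < d" "0 < l" "a dvd m" "b dvd a" "c dvd n" "d dvd c"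
    "s = c div d" "l \<le> s" "coprime l s"
    using assms(1) by (auto simp: J_def s_def coprime_iff_gcd_eq_1)
  have a: "a = b * s" and c: "c = d * s"
    using J(7) J(9) by (simp add: s_def) (simp add: J(10) J(9))
  obtain m' n' where m: "m = a * m'" and n: "n = c * n'"
    using J(6,8) by (auto elim!: dvdE)
  have "n = d * (n' * s)" by (simp add: n c)
  then have "n div d = n' * s" using J(4) by simp
  moreover have "0 < s" using a J(1) by (cases s) auto
  moreover have "0 < m'" "0 < n'" using assms(2,3) m n by (auto intro: Nat.gr0I)
  moreover have "m div a = m'" "n div c = n'" using J(1,3) m n by auto
  moreover have "m = m' * a" "n = n' * c" using m n by auto
  ultimately show thesis
    using that J(2,4,5,11,12) a c s_def[symmetric] by blast
qed

text \<open>The box \<open>i < a\<close>, \<open>j < d\<close> represents all integer pairs: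
  \<open>p\<close> may be reduced modulo \<open>a\<close> because \<open>m' * a = m\<close>, and
  \<open>t\<close> modulo \<open>d\<close> because \<open>n' * s * d = n\<close>.\<close>

lemma K_eq_range:
  assumes "a = b * s" "c = d * s" "m = m' * a" "n = n' * c" "0 < m" "0 < n"
    "m div a = m'" "n div c = n'" "n div d = n' * s"
  shows "K m n a b c d l = range (\<lambda>(p, t).
    (int m' * p mod int m, int n' * (int l * p + int s * t) mod int n))" (is "_ = ?R")
proof
  show "K m n a b c d l \<subseteq> ?R"
  proof
    fix z assume "z \<in> K m n a b c d l"
    then obtain i j where "z = (int (i * m') mod int m, int (i * l * n' + j * (n' * s)) mod int n)"
      unfolding K_def assms(7-9) by blast
    then show "z \<in> ?R"
      by (intro image_eqI[of _ _ "(int i, int j)"]) (auto simp: algebra_simps)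
  qed
  show "?R \<subseteq> K m n a b c d l"
  proof clarsimp
    fix p t :: int
    have pos: "0 < a" "0 < d" using assms(1-6) by auto
    define i where "i = nat (p mod int a)"
    \<comment> \<open>Reducing \<open>p\<close> shifts the second coordinate by \<open>l * a\<close>
      times the quotient; as \<open>a = b * s\<close>, this is a multiple of \<open>s\<close> and
      moves into \<open>t\<close>.\<close>
    define t' where "t' = int l * int b * (p div int a) + t"
    define j where "j = nat (t' mod int d)"
    have ij: "i < a" "j < d" and i: "int i = p mod int a" and j: "int j = t' mod int d"
      using pos by (auto simp: i_def j_def nat_less_iff)
    have p: "p = int i + int a * (p div int a)" by (simp add: i)
    have t': "t' = int j + int d * (t' div int d)" by (simp add: j)
    have "int m' * p = int (i * m') + int m * (p div int a)"
      by (subst p) (simp add: assms(3) algebra_simps)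
    moreover have "int n' * (int l * p + int s * t)
        = int (i * l * n' + j * (n' * s)) + int n * (t' div int d)"
    proof -
      have "int l * p + int s * t = int l * int i + int s * t'"
        by (subst p) (simp add: assms(1) t'_def algebra_simps)
      also have "\<dots> = int l * int i + int s * int j + int c * (t' div int d)"
        by (subst t') (simp add: assms(2) algebra_simps)
      finally show ?thesis
        by (simp add: assms(4) algebra_simps)
    qed
    ultimately show "(int m' * p mod int m, int n' * (int l * p + int s * t) mod int n) \<in> K m n a b c d l"
      unfolding K_def assms(7-9) using ij by fastforce
  qed
qed

text \<open>Congruences become equations because the lattice contains \<open>(m, 0)\<close>, at
  \<open>p = a\<close>, \<open>t = - l * b\<close>, and \<open>(0, n)\<close>, at
  \<open>p = 0\<close>, \<open>t = d\<close>; multiples of these absorb the differences.\<close>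

lemma mod_pair_mem_K_iff:
  assumes "a = b * s" "c = d * s" "m = m' * a" "n = n' * c" "0 < m" "0 < n"
    "m div a = m'" "n div c = n'" "n div d = n' * s"
  shows "(x mod int m, y mod int n) \<in> K m n a b c d l \<longleftrightarrow>
    (\<exists>p t. x = int m' * p \<and> y = int n' * (int l * p + int s * t))"
proof
  assume "(x mod int m, y mod int n) \<in> K m n a b c d l"
  then obtain p t where "x mod int m = int m' * p mod int m"
    and "y mod int n = int n' * (int l * p + int s * t) mod int n"
    unfolding K_eq_range[OF assms] by auto
  then obtain k1 k2 where x: "x = int m' * p + int m * k1"
    and y: "y = int n' * (int l * p + int s * t) + int n * k2"
    by (metis mod_eq_dvd_iff dvd_def add.commute diff_eq_eq)
  have "x = int m' * (p + int a * k1)"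
    by (simp add: x assms(3) algebra_simps)
  moreover have "y = int n' * (int l * (p + int a * k1)
      + int s * (t - int l * int b * k1 + int d * k2))"
    by (simp add: y assms(1,2,4) algebra_simps)
  ultimately show "\<exists>p t. x = int m' * p \<and> y = int n' * (int l * p + int s * t)"
    by blast
next
  assume "\<exists>p t. x = int m' * p \<and> y = int n' * (int l * p + int s * t)"
  then show "(x mod int m, y mod int n) \<in> K m n a b c d l"
    unfolding K_eq_range[OF assms] by auto
qed

section \<open>Smith normal form and the invariant factors of \<open>K\<close>\<close>

text \<open>With \<open>a = g * a'\<close>, the new coordinate
  \<open>Y = \<alpha> * p + a' * t\<close> takes the relations \<open>(a, - l * b)\<close> and
  \<open>(0, d)\<close> to \<open>g * a' * (\<alpha> - l * b')\<close> and
  \<open>g * a' * d' = v\<close>. Choosing \<open>\<alpha>\<close> congruent to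
  \<open>l * b'\<close> modulo \<open>d'\<close> makes both multiples of \<open>v\<close>;
  completing \<open>Y\<close> to a unimodular change of coordinates gives the kernel form that
  \<open>linear_range_Z_prod\<close> expects.\<close>

lemma K_subgroup_decomp:
  assumes "(a, b, c, d, l) \<in> J m n" "0 < m" "0 < n"
  shows "subgroup (K m n a b c d l) (Z_prod m n)"
    and "invariant_factor_decomp (Z_prod m n\<lparr>carrier := K m n a b c d l\<rparr>) (gcd b d) (lcm a c)"
proof -
  obtain s m' n' where eqs: "a = b * s" "c = d * s" "m = m' * a" "n = n' * c"
      "m div a = m'" "n div c = n'" "n div d = n' * s" "a div b = s"
    and pos: "0 < b" "0 < d" "0 < s" "0 < m'" "0 < n'" "0 < l" "l \<le> s" "coprime l s"
    using J_cases[OF assms] by blast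
  note K = K_eq_range[OF eqs(1-4) assms(2,3) eqs(5-7)]
  define g where "g = gcd b d"
  have g0: "0 < g" using pos by (simp add: g_def)
  obtain b' d' where b: "b = g * b'" and d: "d = g * d'" and bd: "coprime b' d'"
    unfolding g_def using gcd_coprime_exists[of b d] pos by (metis gcd_pos_nat mult.commute neq0_conv)
  have b'0: "0 < b'" and d'0: "0 < d'" using pos b d by auto
  define v where "v = lcm a c"
  have v: "v = g * (b' * s) * d'"
  proof -
    have "lcm b d = g * b' * d'"
      using bd by (simp add: b d lcm_mult_left lcm_coprime)
    moreover have "v = lcm b d * s"
      by (simp add: v_def eqs(1,2) lcm_mult_right lcm.commute)
    ultimately show ?thesis by (simp add: mult_ac)
  qed
  have v0: "0 < v" using g0 b'0 d'0 pos by (simp add: v)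
  define a' where "a' = int (b' * s)"
  have a'0: "a' \<noteq> 0" using b'0 pos by (simp add: a'_def)
  \<comment> \<open>The inner gcd is \<open>b'\<close> because \<open>l\<close> and \<open>s\<close>
    are coprime, and \<open>b'\<close> is coprime to \<open>d'\<close>.\<close>
  have "gcd (gcd (b' * s) (l * b')) d' = 1"
  proof -
    have "gcd (b' * s) (l * b') = b' * gcd s l"
      by (simp add: gcd_mult_distrib_nat mult.commute)
    then show ?thesis using pos bd by (simp add: coprime_iff_gcd_eq_1 gcd.commute)
  qed
  then have "gcd (gcd a' (int (l * b'))) (int d') = 1"
    by (metis a'_def gcd_int_int_eq of_nat_1)
  \<comment> \<open>Adding this multiple of \<open>d'\<close> makes \<open>(\<alpha>, a')\<close> primitive, so that it extends to a unimodular matrix.\<close>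
  then obtain k where "coprime a' (int (l * b') + k * int d')"
    using coprime_arithmetic_progression[OF a'0] by meson
  then obtain \<alpha> where \<alpha>: "\<alpha> = int (l * b') + k * int d'" and cop: "coprime a' \<alpha>"
    by blast
  obtain \<gamma> \<delta> where bez: "\<gamma> * a' - \<delta> * \<alpha> = 1"
  proof -
    obtain x y where "x * a' + y * \<alpha> = 1"
      using bezout_int[of a' \<alpha>] cop by (auto simp: coprime_iff_gcd_eq_1)
    then show thesis by (intro that[of x "-y"]) simp
  qed
  \<comment> \<open>The matrix with rows \<open>(\<gamma>, \<delta>)\<close> and \<open>(\<alpha>, a')\<close> is unimodular; \<open>P\<close> and \<open>T\<close> are its inverse.\<close>
  define P where "P = (\<lambda>X Y. a' * X - \<delta> * Y)"
  define T where "T = (\<lambda>X Y. \<gamma> * Y - \<alpha> * X)"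
  have inv1: "\<gamma> * P X Y + \<delta> * T X Y = X" "\<alpha> * P X Y + a' * T X Y = Y" for X Y
  proof -
    have "\<gamma> * P X Y + \<delta> * T X Y = (\<gamma> * a' - \<delta> * \<alpha>) * X"
      by (simp add: P_def T_def algebra_simps)
    then show "\<gamma> * P X Y + \<delta> * T X Y = X" by (simp add: bez)
    have "\<alpha> * P X Y + a' * T X Y = (\<gamma> * a' - \<delta> * \<alpha>) * Y"
      by (simp add: P_def T_def algebra_simps)
    then show "\<alpha> * P X Y + a' * T X Y = Y" by (simp add: bez)
  qed
  have inv2: "P (\<gamma> * p + \<delta> * t) (\<alpha> * p + a' * t) = p"
    "T (\<gamma> * p + \<delta> * t) (\<alpha> * p + a' * t) = t" for p t
  proof -
    have "P (\<gamma> * p + \<delta> * t) (\<alpha> * p + a' * t) = (\<gamma> * a' - \<delta> * \<alpha>) * p"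
      by (simp add: P_def algebra_simps)
    then show "P (\<gamma> * p + \<delta> * t) (\<alpha> * p + a' * t) = p" by (simp add: bez)
    have "T (\<gamma> * p + \<delta> * t) (\<alpha> * p + a' * t) = (\<gamma> * a' - \<delta> * \<alpha>) * t"
      by (simp add: T_def algebra_simps)
    then show "T (\<gamma> * p + \<delta> * t) (\<alpha> * p + a' * t) = t" by (simp add: bez)
  qed
  define F where "F = (\<lambda>X Y. int m' * P X Y)"
  define G where "G = (\<lambda>X Y. int n' * (int l * P X Y + int s * T X Y))"
  have a_eq: "int a = int g * a'" and v_eq: "int v = int g * a' * int d'"
    by (simp_all add: eqs(1) b a'_def v)
  have ker: "int m dvd F X Y \<and> int n dvd G X Y \<longleftrightarrow> int g dvd X \<and> int v dvd Y" for X Y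
  proof -
    let ?p = "P X Y" and ?t = "T X Y"
    have "int m dvd F X Y \<longleftrightarrow> int a dvd ?p"
      using pos by (simp add: F_def eqs(3))
    moreover have "int n dvd G X Y \<longleftrightarrow> int c dvd int l * ?p + int s * ?t"
      using pos by (simp add: G_def eqs(4))
    moreover have "int a dvd ?p \<and> int c dvd int l * ?p + int s * ?t \<longleftrightarrow> int g dvd X \<and> int v dvd Y"
    proof
      assume H: "int a dvd ?p \<and> int c dvd int l * ?p + int s * ?t"
      then obtain e where e: "?p = int a * e" by blast
      have "int l * ?p + int s * ?t = int s * (int l * int b * e + ?t)"
        by (simp add: e eqs(1) algebra_simps)
      with H have "int d dvd int l * int b * e + ?t"
        using pos by (simp add: eqs(2) mult.commute[of "int d"])
      then obtain f where f: "?t = int d * f - int l * int b * e"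
        by (metis add_diff_cancel_left' dvdE)
      have "X = \<gamma> * ?p + \<delta> * ?t" by (simp add: inv1)
      also have "\<dots> = int g * (\<gamma> * a' * e + \<delta> * (int d' * f - int l * int b' * e))"
        by (simp add: e f a_eq b d algebra_simps)
      finally have "int g dvd X" by (rule dvdI)
      \<comment> \<open>The terms in \<open>e\<close> collect to
        \<open>\<alpha> - l * b' = k * d'\<close>, which supplies the factor \<open>d'\<close> of
        \<open>v\<close>.\<close>
      moreover have "Y = \<alpha> * ?p + a' * ?t" by (simp add: inv1)
      then have "Y = int v * (k * e + f)"
        by (simp add: e f a_eq b d v_eq \<alpha> algebra_simps)
      ultimately show "int g dvd X \<and> int v dvd Y" by simp
    next
      assume H: "int g dvd X \<and> int v dvd Y"
      then obtain X' Y' where X: "X = int g * X'" and Y: "Y = int g * (a' * int d' * Y')"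
        by (metis dvdE mult.assoc v_eq)
      \<comment> \<open>By linearity the common factor \<open>g\<close> can be divided out of both
        old coordinates.\<close>
      define p t where "p = P X' (a' * int d' * Y')" and "t = T X' (a' * int d' * Y')"
      have p: "?p = int g * p" and t: "?t = int g * t"
        by (simp_all add: p_def t_def P_def T_def X Y algebra_simps)
      have pt: "\<alpha> * p + a' * t = a' * int d' * Y'" by (simp add: p_def t_def inv1)
      \<comment> \<open>Primitivity of the row \<open>(\<alpha>, a')\<close> now forces
        \<open>a'\<close> to divide \<open>p\<close>.\<close>
      then have "\<alpha> * p = a' * (int d' * Y' - t)" by (simp add: algebra_simps)
      then have "a' dvd p" using cop by (metis coprime_dvd_mult_right_iff dvd_triv_left)
      then obtain e where e: "p = a' * e" by blast
      have "a' * (\<alpha> * e + t) = a' * (int d' * Y')"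
        using pt by (simp add: e algebra_simps)
      then have "\<alpha> * e + t = int d' * Y'" using a'0 by simp
      then have "int l * int b' * e + t = int d' * (Y' - k * e)"
        by (simp add: \<alpha> algebra_simps)
      moreover have "int l * ?p + int s * ?t = int g * int s * (int l * int b' * e + t)"
        by (simp add: p t e a'_def algebra_simps)
      moreover have "int c = int g * int s * int d'"
        by (simp add: eqs(2) d)
      ultimately have "int l * ?p + int s * ?t = int c * (Y' - k * e)"
        by (simp add: mult.assoc)
      moreover have "?p = int a * e" by (simp add: p e a_eq)
      ultimately show "int a dvd ?p \<and> int c dvd int l * ?p + int s * ?t" by simp
    qed
    ultimately show ?thesis by simp
  qed
  have S: "K m n a b c d l = range (\<lambda>(X, Y). (F X Y mod int m, G X Y mod int n))"
  proof
    show "range (\<lambda>(X, Y). (F X Y mod int m, G X Y mod int n)) \<subseteq> K m n a b c d l"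
      unfolding K F_def G_def by fast
    show "K m n a b c d l \<subseteq> range (\<lambda>(X, Y). (F X Y mod int m, G X Y mod int n))"
    proof
      fix z assume "z \<in> K m n a b c d l"
      then obtain p t where "z = (int m' * p mod int m, int n' * (int l * p + int s * t) mod int n)"
        unfolding K by fast
      then show "z \<in> range (\<lambda>(X, Y). (F X Y mod int m, G X Y mod int n))"
        unfolding F_def G_def
        by (intro image_eqI[of _ _ "(\<gamma> * p + \<delta> * t, \<alpha> * p + a' * t)"]) (simp_all only: inv2 prod.case UNIV_I)
    qed
  qed
  have F_lin: "F X Y = (int m' * a') * X + (- int m' * \<delta>) * Y"
    and G_lin: "G X Y = int n' * (int l * a' - int s * \<alpha>) * X + int n' * (int s * \<gamma> - int l * \<delta>) * Y"
    for X Y by (simp_all add: F_def G_def P_def T_def algebra_simps)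
  note * = linear_range_Z_prod[OF F_lin G_lin assms(2,3) g0 v0 ker S]
  show "subgroup (K m n a b c d l) (Z_prod m n)" by (rule *)
  show "invariant_factor_decomp (Z_prod m n\<lparr>carrier := K m n a b c d l\<rparr>) (gcd b d) (lcm a c)"
    using *(2) g0 v0 unfolding g_def[symmetric] v_def[symmetric]
    by (simp add: invariant_factor_decomp_def v)
qed

section \<open>Injectivity: the lattice determines the parameters\<close>

text \<open>Inclusion of lattices passes to both projections. The first projection is generated by
  \<open>m1\<close>; the second contains \<open>n1\<close> itself, by a Bezout relation between
  \<open>l1\<close> and \<open>s1\<close>.\<close>

lemma lattice_le_dvd:
  fixes m1 n1 m2 n2 s1 s2 l1 l2 :: nat
  assumes le: "\<And>x y. \<exists>p t. x = int m1 * p \<and> y = int n1 * (int l1 * p + int s1 * t) \<Longrightarrow>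
      \<exists>p t. x = int m2 * p \<and> y = int n2 * (int l2 * p + int s2 * t)"
    and "coprime l1 s1"
  shows "m2 dvd m1" "n2 dvd n1"
proof -
  have "\<exists>p t. int m1 = int m2 * p \<and> int n1 * int l1 = int n2 * (int l2 * p + int s2 * t)"
    by (rule le, rule exI[of _ 1], rule exI[of _ 0]) simp
  then show "m2 dvd m1" by (metis dvdI int_dvd_int_iff)
  obtain p t where "p * int l1 + t * int s1 = 1"
    using bezout_int[of "int l1" "int s1"] assms(2)
    by (metis coprime_iff_gcd_eq_1 coprime_int_iff)
  then have "\<exists>p t. int m2 * p = int m2 * p \<and> int n1 = int n1 * (int l1 * p + int s1 * t)"
    by (metis mult.commute mult.right_neutral)
  then obtain p t where "int n1 = int n1 * (int l1 * p + int s1 * t)" by blast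
  then have "\<exists>q r. int m1 * p = int m2 * q \<and> int n1 = int n2 * (int l2 * q + int s2 * r)"
    by (intro le) blast
  then show "n2 dvd n1" by (metis dvdI int_dvd_int_iff)
qed

text \<open>Test points: \<open>(0, n' * s1)\<close> forces \<open>p = 0\<close> in the second
  lattice, and \<open>(m', n' * l1)\<close> forces \<open>p = 1\<close>.\<close>

lemma lattice_le_dvd':
  fixes m' n' s1 s2 l1 l2 :: nat
  assumes le: "\<And>x y. \<exists>p t. x = int m' * p \<and> y = int n' * (int l1 * p + int s1 * t) \<Longrightarrow>
      \<exists>p t. x = int m' * p \<and> y = int n' * (int l2 * p + int s2 * t)"
    and "0 < m'" "0 < n'"
  shows "s2 dvd s1" "int s2 dvd int l1 - int l2"
proof -
  have "\<exists>p t. 0 = int m' * p \<and> int n' * int s1 = int n' * (int l2 * p + int s2 * t)"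
    by (rule le, rule exI[of _ 0], rule exI[of _ 1]) simp
  then show "s2 dvd s1" using assms(2,3) by (auto simp flip: int_dvd_int_iff)
  have "\<exists>p t. int m' = int m' * p \<and> int n' * int l1 = int n' * (int l2 * p + int s2 * t)"
    by (rule le, rule exI[of _ 1], rule exI[of _ 0]) simp
  then show "int s2 dvd int l1 - int l2" using assms(2,3) by auto
qed

lemma K_inj:
  assumes 1: "(a1, b1, c1, d1, l1) \<in> J m n" and 2: "(a2, b2, c2, d2, l2) \<in> J m n"
    and mn: "0 < m" "0 < n" and eq: "K m n a1 b1 c1 d1 l1 = K m n a2 b2 c2 d2 l2"
  shows "(a1, b1, c1, d1, l1) = (a2, b2, c2, d2, l2)"
proof -
  obtain s1 m1 n1 where e1: "a1 = b1 * s1" "c1 = d1 * s1" "m = m1 * a1" "n = n1 * c1"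
      "m div a1 = m1" "n div c1 = n1" "n div d1 = n1 * s1" "a1 div b1 = s1"
    and p1: "0 < b1" "0 < d1" "0 < s1" "0 < m1" "0 < n1" "0 < l1" "l1 \<le> s1" "coprime l1 s1"
    using J_cases[OF 1 mn] by blast
  obtain s2 m2 n2 where e2: "a2 = b2 * s2" "c2 = d2 * s2" "m = m2 * a2" "n = n2 * c2"
      "m div a2 = m2" "n div c2 = n2" "n div d2 = n2 * s2" "a2 div b2 = s2"
    and p2: "0 < b2" "0 < d2" "0 < s2" "0 < m2" "0 < n2" "0 < l2" "l2 \<le> s2" "coprime l2 s2"
    using J_cases[OF 2 mn] by blast
  have iff: "(\<exists>p t. x = int m1 * p \<and> y = int n1 * (int l1 * p + int s1 * t)) \<longleftrightarrow>
      (\<exists>p t. x = int m2 * p \<and> y = int n2 * (int l2 * p + int s2 * t))" for x y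
    using eq mod_pair_mem_K_iff[OF e1(1-4) mn e1(5-7), of x y l1]
      mod_pair_mem_K_iff[OF e2(1-4) mn e2(5-7), of x y l2] by simp
  have m12: "m1 = m2" and n12: "n1 = n2"
    using lattice_le_dvd[OF iff[THEN iffD1] p1(8)] lattice_le_dvd[OF iff[THEN iffD2] p2(8)]
    by (auto intro: dvd_antisym)
  note iff' = iff[unfolded m12 n12]
  have s12: "s1 = s2" and l: "int s2 dvd int l1 - int l2"
    using lattice_le_dvd'[OF iff'[THEN iffD1] p2(4,5)] lattice_le_dvd'[OF iff'[THEN iffD2] p2(4,5)]
    by (auto intro: dvd_antisym)
  \<comment> \<open>Both lie between 1 and the common \<open>s2\<close>, so a difference divisible
    by \<open>s2\<close> must vanish.\<close>
  have "l1 = l2"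
  proof (rule ccontr)
    assume "l1 \<noteq> l2"
    then have "int s2 \<le> \<bar>int l1 - int l2\<bar>"
      using l dvd_imp_le_int[of "int l1 - int l2" "int s2"] by simp
    then show False using p1 p2 s12 by linarith
  qed
  moreover have "a1 = a2" "c1 = c2"
    using e1(3,4) e2(3,4) m12 n12 p2 by auto
  ultimately show ?thesis
    using e1(1,2) e2(1,2) s12 p2 by auto
qed

section \<open>Surjectivity: reading the parameters off a subgroup\<close>

text \<open>The least positive element generates: closure under differences makes \<open>S\<close> a
  subgroup, and a nonzero remainder modulo \<open>g\<close> would be a smaller positive
  element.\<close>

lemma int_subgroup_principal:
  fixes S :: "int set"
  assumes diff: "\<And>x y. x \<in> S \<Longrightarrow> y \<in> S \<Longrightarrow> x - y \<in> S" and N: "int N \<in> S" "0 < N"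
  obtains g where "0 < g" "int g \<in> S" "\<And>x. x \<in> S \<Longrightarrow> int g dvd x"
proof -
  define g where "g = (LEAST g. 0 < g \<and> int g \<in> S)"
  have g: "0 < g" "int g \<in> S"
    using LeastI[of "\<lambda>g. 0 < g \<and> int g \<in> S" N] N unfolding g_def by auto
  have 0: "0 \<in> S" using diff[OF N(1) N(1)] by simp
  have neg: "- x \<in> S" if "x \<in> S" for x using diff[OF 0 that] by simp
  have add: "x + y \<in> S" if "x \<in> S" "y \<in> S" for x y using diff[OF that(1) neg[OF that(2)]] by simp
  have mult: "int k * int g \<in> S" for k
    by (induction k) (auto simp: 0 algebra_simps intro: add g(2))
  have mult': "k * int g \<in> S" for k
    using mult[of "nat k"] neg[OF mult[of "nat (-k)"]] by (cases "0 \<le> k") auto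
  have "int g dvd x" if "x \<in> S" for x
  proof (rule ccontr)
    assume ndvd: "\<not> int g dvd x"
    have "x mod int g \<in> S"
      using diff[OF that mult'[of "x div int g"]] by (simp add: minus_div_mult_eq_mod)
    moreover have "0 < x mod int g" "x mod int g < int g"
      using g ndvd by (auto simp: dvd_eq_mod_eq_0 order.not_eq_order_implies_strict)
    ultimately have "0 < nat (x mod int g)" "int (nat (x mod int g)) \<in> S" "nat (x mod int g) < g"
      by auto
    then show False
      using not_less_Least[of "nat (x mod int g)" "\<lambda>g. 0 < g \<and> int g \<in> S"] by (simp add: g_def)
  qed
  with g that show thesis by blast
qed

lemma K_surj:
  assumes H: "subgroup H (Z_prod m n)" and mn: "0 < m" "0 < n"
  obtains a b c d l where "(a, b, c, d, l) \<in> J m n" "H = K m n a b c d l"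
proof -
  interpret group "Z_prod m n" by (rule group_Z_prod)
  interpret subgroup H "Z_prod m n" by (rule H)
  define L where "L = (\<lambda>x y. (x mod int m, y mod int n) \<in> H)"
  have L0: "L x y" if "int m dvd x" "int n dvd y" for x y
    using one_closed that by (simp add: L_def)
  have Lneg: "L (- x) (- y)" if "L x y" for x y
  proof -
    have "inv\<^bsub>Z_prod m n\<^esub> (x mod int m, y mod int n) \<in> H"
      using that by (simp add: L_def m_inv_closed)
    then show ?thesis
      using mn by (simp add: L_def carrier_integer_mod_group mod_minus_eq)
  qed
  have Ladd: "L (x + x') (y + y')" if "L x y" "L x' y'" for x y x' y'
    using m_closed[OF that[unfolded L_def]] by (simp add: L_def mod_add_eq)
  have Ldiff: "L (x - x') (y - y')" if "L x y" "L x' y'" for x y x' y'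
    using Ladd[OF that(1) Lneg[OF that(2)]] by simp
  have Lmult: "L (k * x) (k * y)" if "L x y" for k x y
  proof -
    have nat: "L (int j * x) (int j * y)" for j
      by (induction j) (auto simp: L0 algebra_simps intro: Ladd that)
    show ?thesis
      using nat[of "nat k"] Lneg[OF nat[of "nat (-k)"]] by (cases "0 \<le> k") auto
  qed
  \<comment> \<open>\<open>L\<close> is the preimage lattice of \<open>H\<close>. The numbers
    \<open>m'\<close>, \<open>n'\<close> and \<open>r\<close> generate its two projections and its
    intersection with the second axis.\<close>
  obtain m' where m': "0 < m'" "\<exists>y. L (int m') y" "\<And>x y. L x y \<Longrightarrow> int m' dvd x"
  proof (rule int_subgroup_principal[of "{x. \<exists>y. L x y}" m])
    show "int m \<in> {x. \<exists>y. L x y}" using L0[of "int m" 0] by auto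
  qed (use mn Ldiff in blast)+
  obtain n' where n': "0 < n'" "\<exists>x. L x (int n')" "\<And>x y. L x y \<Longrightarrow> int n' dvd y"
  proof (rule int_subgroup_principal[of "{y. \<exists>x. L x y}" n])
    show "int n \<in> {y. \<exists>x. L x y}" using L0[of 0 "int n"] by auto
  qed (use mn Ldiff in blast)+
  obtain r where r: "0 < r" "L 0 (int r)" "\<And>y. L 0 y \<Longrightarrow> int r dvd y"
  proof (rule int_subgroup_principal[of "{y. L 0 y}" n])
    show "int n \<in> {y. L 0 y}" using L0[of 0 "int n"] by auto
    show "x - y \<in> {y. L 0 y}" if "x \<in> {y. L 0 y}" "y \<in> {y. L 0 y}" for x y
      using that Ldiff[of 0 x 0 y] by simp
  qed (use mn in blast)+
  obtain s where s: "r = n' * s" "0 < s"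
    using n'(3)[OF r(2)] r(1) by (metis dvdE int_dvd_int_iff nat_0_less_mult_iff)
  obtain l0 where l0: "L (int m') (int n' * l0)"
    using m'(2) n'(3) by (metis dvdE)
  \<comment> \<open>\<open>J\<close> takes residues modulo \<open>s\<close> from 1 to
    \<open>s\<close>, so residue 0 must be represented by \<open>s\<close>. By the coprimality shown
    below, this happens only for \<open>s = 1\<close>.\<close>
  define l where "l = (if s = 1 then 1 else nat (l0 mod int s))"
  have l_cong: "\<exists>k. l0 = int l + int s * k"
  proof (cases "s = 1")
    case False
    then have "int l = l0 mod int s" using s(2) by (simp add: l_def)
    then show ?thesis by (metis mod_mult_div_eq)
  qed (auto simp: l_def intro: exI[of _ "l0 - 1"])
  then obtain k where k: "l0 = int l + int s * k" ..
  have Ls: "L 0 (int n' * (int s * t))" for t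
    using Lmult[OF r(2), of t] by (simp add: s(1) algebra_simps)
  have Ll: "L (int m') (int n' * int l)"
    using Ldiff[OF l0 Ls[of k]] by (simp add: k algebra_simps)
  have L_iff: "L x y \<longleftrightarrow> (\<exists>p t. x = int m' * p \<and> y = int n' * (int l * p + int s * t))" for x y
  proof
    assume xy: "L x y"
    then obtain p q where p: "x = int m' * p" and q: "y = int n' * q"
      using m'(3) n'(3) by (metis dvdE)
    \<comment> \<open>Subtracting \<open>p\<close> times the point \<open>(m', n' * l)\<close> lands
      on the second axis, where \<open>r = n' * s\<close> divides.\<close>
    have "L (x - p * int m') (y - p * (int n' * int l))"
      by (intro Ldiff xy Lmult Ll)
    then have "L 0 (int n' * (q - p * int l))"
      by (simp add: p q algebra_simps)
    then have "int s dvd q - p * int l"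
      using r(3) n'(1) by (fastforce simp: s(1))
    then obtain t where "q - p * int l = int s * t" by blast
    then have "y = int n' * (int l * p + int s * t)"
      by (simp add: q algebra_simps)
    with p show "\<exists>p t. x = int m' * p \<and> y = int n' * (int l * p + int s * t)" by blast
  next
    assume "\<exists>p t. x = int m' * p \<and> y = int n' * (int l * p + int s * t)"
    then obtain p t where "x = int m' * p" "y = int n' * (int l * p + int s * t)" by blast
    then show "L x y"
      using Ladd[OF Lmult[OF Ll, of p] Ls[of t]] by (simp add: algebra_simps)
  qed
  \<comment> \<open>As generator of the second projection, \<open>n'\<close> is itself the second
    coordinate of a lattice point; this yields a Bezout relation.\<close>
  have cop: "coprime l s"
  proof -
    obtain x where "L x (int n')" using n'(2) by blast
    then obtain p t where "int n' = int n' * (int l * p + int s * t)" by (auto simp: L_iff)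
    then have "int l * p + int s * t = 1" using n'(1) by simp
    then have "coprime (int l) (int s)"
      by (metis coprimeI dvd_add dvd_mult2)
    then show ?thesis by simp
  qed
  have l_bounds: "0 < l" "l \<le> s"
  proof -
    show "l \<le> s" using s(2) by (auto simp: l_def nat_le_iff order.strict_implies_order)
    show "0 < l" using cop s(2) by (cases "l = 0") (auto simp: l_def)
  qed
  define a where "a = m div m'"
  define c where "c = n div n'"
  have "L (int m) 0" "L 0 (int n)" by (simp_all add: L0)
  then have "m' dvd m" "n' dvd n" using m'(3) n'(3) by (auto simp flip: int_dvd_int_iff)
  then have a: "m = m' * a" and c: "n = n' * c" by (simp_all add: a_def c_def)
  have "s dvd c"
    using r(3)[OF \<open>L 0 (int n)\<close>] n'(1) by (simp add: s(1) c)
  \<comment> \<open>The lattice point \<open>(m, 0)\<close> has \<open>p = a\<close>, so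
    \<open>s\<close> divides \<open>l * a\<close>, and coprimality removes \<open>l\<close>.\<close>
  have "s dvd a"
  proof -
    obtain p t where "int m = int m' * p" "0 = int n' * (int l * p + int s * t)"
      using \<open>L (int m) 0\<close> by (auto simp: L_iff)
    then have "p = int a" "int l * p + int s * t = 0" using m'(1) n'(1) by (simp_all add: a)
    then have "int s dvd int l * int a"
      by (metis add.inverse_inverse add_eq_0_iff dvd_minus_iff dvd_triv_left)
    then show ?thesis
      using cop by (metis coprime_commute coprime_dvd_mult_right_iff int_dvd_int_iff of_nat_mult)
  qed
  define b where "b = a div s"
  define d where "d = c div s"
  have ab: "a = b * s" and cd: "c = d * s"
    using \<open>s dvd a\<close> \<open>s dvd c\<close> by (simp_all add: b_def d_def)
  have pos: "0 < a" "0 < b" "0 < c" "0 < d" using mn a c ab cd by (auto intro: Nat.gr0I)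
  have J: "(a, b, c, d, l) \<in> J m n"
    using pos l_bounds cop by (simp add: J_def a c ab cd coprime_iff_gcd_eq_1)
  have divs: "m div a = m'" "n div c = n'" "n div d = n' * s"
    using pos by (simp_all add: a c cd)
  note mem = mod_pair_mem_K_iff[OF ab cd a c mn divs, of _ _ l]
  have "H = K m n a b c d l"
  proof -
    have "z \<in> H \<longleftrightarrow> z \<in> K m n a b c d l" if "z \<in> carrier (Z_prod m n)" for z
      using that mn mem[of "fst z" "snd z"] L_iff[of "fst z" "snd z"]
      by (auto simp: L_def carrier_integer_mod_group)
    moreover have "K m n a b c d l \<subseteq> carrier (Z_prod m n)"
      using K_subgroup_decomp(1)[OF J mn] subgroup.subset by blast
    ultimately show ?thesis using subset by blast
  qed
  with J that show thesis by blast
qed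

section \<open>Bijection and group invariants combined\<close>

theorem theorem3p1:
  fixes m n :: nat
  assumes "0 < m" and "0 < n"
  shows "bij_betw (\<lambda>(a, b, c, d, l). K m n a b c d l) (J m n) {H. subgroup H (Z_prod m n)} \<and>
    (\<forall>(a, b, c, d, l) \<in> J m n.
       invariant_factor_decomp (Z_prod m n\<lparr>carrier := K m n a b c d l\<rparr>) (gcd b d) (lcm a c)) \<and>
    (\<forall>(a, b, c, d, l) \<in> J m n.
       order (Z_prod m n\<lparr>carrier := K m n a b c d l\<rparr>) = a * d \<and>
       group_exponent (Z_prod m n\<lparr>carrier := K m n a b c d l\<rparr>) = lcm a c) \<and>
    (\<forall>(a, b, c, d, l) \<in> J m n.
       cyclic_group (Z_prod m n\<lparr>carrier := K m n a b c d l\<rparr>) \<longleftrightarrow> gcd b d = 1)"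
proof (intro conjI)
  show "bij_betw (\<lambda>(a, b, c, d, l). K m n a b c d l) (J m n) {H. subgroup H (Z_prod m n)}"
    unfolding bij_betw_def
  proof
    show "inj_on (\<lambda>(a, b, c, d, l). K m n a b c d l) (J m n)"
      unfolding inj_on_def using K_inj[OF _ _ assms] by fast
    show "(\<lambda>(a, b, c, d, l). K m n a b c d l) ` J m n = {H. subgroup H (Z_prod m n)}"
    proof (intro equalityI subsetI)
      fix H assume "H \<in> {H. subgroup H (Z_prod m n)}"
      then obtain a b c d l where "(a, b, c, d, l) \<in> J m n" "H = K m n a b c d l"
        using K_surj[OF _ assms] by blast
      then show "H \<in> (\<lambda>(a, b, c, d, l). K m n a b c d l) ` J m n"
        by (intro image_eqI[of _ _ "(a, b, c, d, l)"]) auto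
    qed (use K_subgroup_decomp(1)[OF _ assms] in auto)
  qed
next
  \<comment> \<open>Scaling by \<open>s\<close> gives \<open>lcm a c = lcm b d * s\<close>, so the
    product of the invariant factors is \<open>b * d * s\<close>.\<close>
  have order_eq: "gcd b d * lcm a c = a * d" if J: "(a, b, c, d, l) \<in> J m n" for a b c d l
  proof -
    obtain s where "a = b * s" "c = d * s"
      using J_cases[OF J assms] by blast
    then have "lcm a c = lcm b d * s" by (simp add: lcm_mult_right lcm.commute)
    then show ?thesis
      using \<open>a = b * s\<close> prod_gcd_lcm_nat[of b d] by (simp add: algebra_simps)
  qed
  note decomp = K_subgroup_decomp(2)[OF _ assms]
  have grp: "group (Z_prod m n\<lparr>carrier := K m n a b c d l\<rparr>)" if "(a, b, c, d, l) \<in> J m n" for a b c d l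
    using K_subgroup_decomp(1)[OF that assms] group_Z_prod by (rule subgroup.subgroup_is_group)
  note inv = invariant_factor_decomp_consequences[OF decomp grp]
  show "\<forall>(a, b, c, d, l) \<in> J m n.
       invariant_factor_decomp (Z_prod m n\<lparr>carrier := K m n a b c d l\<rparr>) (gcd b d) (lcm a c)"
    using decomp by auto
  show "\<forall>(a, b, c, d, l) \<in> J m n.
       order (Z_prod m n\<lparr>carrier := K m n a b c d l\<rparr>) = a * d \<and>
       group_exponent (Z_prod m n\<lparr>carrier := K m n a b c d l\<rparr>) = lcm a c"
    using inv(1,2) order_eq by auto
  show "\<forall>(a, b, c, d, l) \<in> J m n.
       cyclic_group (Z_prod m n\<lparr>carrier := K m n a b c d l\<rparr>) \<longleftrightarrow> gcd b d = 1"
    using inv(3) by auto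
qed

end
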